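(* For every $n$, every $\alpha=\alpha(n)\ge1$, and every $p\in[n^{1/2},n^2]$, there exist an $n$-node directed weighted graph $G$ and a set $P$ of $|P|=p$ demand pairs such that every $\alpha$-approximate distance preserver of $G,P$ has $\Omega(n^{2/3}p^{2/3})$ edges.
   Context: Given a graph $G$ and demand pairs $P\subseteq V(G)\times V(G)$ with $t$ reachable from $s$ for each $(s,t)\in P$, a subgraph $H$ of $G$ is an $\alpha$-approximate distance preserver of $G,P$ if for every $(s,t)\in P$, $s$ can reach $t$ in $H$ and $\mathrm{dist}_H(s,t)\le\alpha\cdot\mathrm{dist}_G(s,t)$. The implicit constant in $\Omega$ is absolute (independent of $\alpha$). *)

theory Defs
  imports "Graph_Theory.Graph_Theory" Complex_Main
begin

text \<open>
  Weights are strictly positive reals, and graphs are finite and simple (no loops, no parallel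
  arcs; antiparallel arcs are allowed). Both are the more restrictive choice, hence the stronger
  one where the existence of a weighted graph is claimed.
\<close>

definition weighted_digraph :: "('a, 'b) pre_digraph \<Rightarrow> 'b weight_fun \<Rightarrow> bool" where
  "weighted_digraph G w \<longleftrightarrow> digraph G \<and> (\<forall>e \<in> arcs G. w e > 0)"

definition demand_pairs :: "('a, 'b) pre_digraph \<Rightarrow> ('a \<times> 'a) set \<Rightarrow> bool" where
  "demand_pairs G P \<longleftrightarrow>
     P \<subseteq> verts G \<times> verts G \<and> (\<forall>(s, t) \<in> P. s \<rightarrow>\<^sup>*\<^bsub>G\<^esub> t)"

text \<open>
  A subgraph inherits the weights of the ambient graph, so the same \<open>w\<close> is used for both.
  The distance \<open>wf_digraph.\<mu>\<close> is the infimum of the costs of all walks, an extended real that is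
  \<open>\<infinity>\<close> if there is no walk. A subgraph may omit vertices as well as arcs.
\<close>

definition approx_distance_preserver ::
  "real \<Rightarrow> ('a, 'b) pre_digraph \<Rightarrow> 'b weight_fun \<Rightarrow> ('a \<times> 'a) set \<Rightarrow> ('a, 'b) pre_digraph \<Rightarrow> bool" where
  "approx_distance_preserver \<alpha> G w P H \<longleftrightarrow>
     subgraph H G \<and>
     (\<forall>(s, t) \<in> P. s \<rightarrow>\<^sup>*\<^bsub>H\<^esub> t \<and>
        wf_digraph.\<mu> H w s t \<le> ereal \<alpha> * wf_digraph.\<mu> G w s t)"

end

theory Submission
  imports Defs
begin

text \<open>
  Vertex \<open>0\<close> is a hub joined to every vertex in both directions by very expensive arcs, so that
  any pair is a legitimate demand pair. Between positive vertices there are arcs \<open>u \<rightarrow> u + Y + m\<close>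
  of cost \<open>K ^ m\<close> for \<open>m < M\<close>. They form a one-dimensional unrolling of the grid whose lines have
  \<open>Y\<close> as horizontal unit and slope \<open>m\<close>. The demand pairs are the ends of the progressions of
  \<open>k\<close> steps \<open>Y + m\<close>. Since \<open>k * (M - 1) < Y\<close>, a walk between such ends that uses only
  slopes \<open>\<le> m\<close> has exactly \<open>k\<close> steps and hence is the progression itself, whereas a single arc
  of slope \<open>> m\<close> (or a hub arc) already costs at least \<open>K ^ (m + 1) > \<alpha> * k * K ^ m\<close>. So a preserver
  contains all the progressions, which are pairwise arc-disjoint. The bound follows by taking
  \<open>k\<close> of order \<open>(n\<^sup>2 / p) powr (1/3)\<close>, \<open>Y\<close> of order \<open>n / k\<close> and \<open>M\<close> about \<open>Y / k\<close>.
\<close>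

section \<open>The weighted hub graph\<close>

definition hub_graph :: "nat \<Rightarrow> nat \<Rightarrow> nat \<Rightarrow> (nat, nat \<times> nat) pre_digraph" where
  "hub_graph n Y M =
     \<lparr>verts = {..<n},
      arcs = {(u, v). u < n \<and> v < n \<and> u \<noteq> v \<and> (u = 0 \<or> v = 0 \<or> u + Y \<le> v \<and> v < u + Y + M)},
      tail = fst, head = snd\<rparr>"

text \<open>Hub arcs are priced like an arc of slope \<open>M\<close>, one above the largest slope,
  so the threshold \<open>K ^ Suc m\<close> with \<open>m < M\<close> excludes them together with
  the steep arcs.\<close>

definition hub_weight :: "real \<Rightarrow> nat \<Rightarrow> nat \<Rightarrow> (nat \<times> nat) weight_fun" where
  "hub_weight K Y M = (\<lambda>(u, v). if u = 0 \<or> v = 0 then K ^ M else K ^ (v - u - Y))"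

lemma hub_graph_sel [simp]:
  "verts (hub_graph n Y M) = {..<n}"
  "tail (hub_graph n Y M) = fst"
  "head (hub_graph n Y M) = snd"
  by (auto simp: hub_graph_def)

lemma mem_arcs_hub_graph:
  "(u, v) \<in> arcs (hub_graph n Y M) \<longleftrightarrow>
     u < n \<and> v < n \<and> u \<noteq> v \<and> (u = 0 \<or> v = 0 \<or> u + Y \<le> v \<and> v < u + Y + M)"
  by (simp add: hub_graph_def)

lemma digraph_hub_graph: "digraph (hub_graph n Y M)"
proof
  have "arcs (hub_graph n Y M) \<subseteq> {..<n} \<times> {..<n}"
    by (auto simp: mem_arcs_hub_graph)
  then show "finite (arcs (hub_graph n Y M))"
    by (rule finite_subset) simp
qed (auto simp: mem_arcs_hub_graph arc_to_ends_def)

lemma weighted_digraph_hub_graph: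
  assumes "K > 0"
  shows "weighted_digraph (hub_graph n Y M) (hub_weight K Y M)"
  using assms digraph_hub_graph by (auto simp: weighted_digraph_def hub_weight_def)

lemma reachable_hub_graph:
  assumes "u < n" "v < n"
  shows "u \<rightarrow>\<^sup>*\<^bsub>hub_graph n Y M\<^esub> v"
proof -
  interpret digraph "hub_graph n Y M" by (rule digraph_hub_graph)
  have "x \<rightarrow>\<^sup>*\<^bsub>hub_graph n Y M\<^esub> y" if "x < n" "y < n" "x = 0 \<or> y = 0" for x y
  proof (cases "x = y")
    case False
    then have "(x, y) \<in> arcs (hub_graph n Y M)"
      using that by (auto simp: mem_arcs_hub_graph)
    then have "x \<rightarrow>\<^bsub>hub_graph n Y M\<^esub> y"
      by (auto simp: arcs_ends_conv intro!: image_eqI[of _ _ "(x, y)"])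
    then show ?thesis by simp
  qed (use that in auto)
  from this[of u 0] this[of 0 v] have "u \<rightarrow>\<^sup>*\<^bsub>hub_graph n Y M\<^esub> 0" "0 \<rightarrow>\<^sup>*\<^bsub>hub_graph n Y M\<^esub> v"
    using assms by simp_all
  then show ?thesis by (rule reachable_trans)
qed

section \<open>Walks with bounded steps and arithmetic progressions\<close>

text \<open>The bounds add up over the steps, and equality in the upper one forces every single step
  to be maximal, so the walk must be the progression of difference \<open>d\<close>.\<close>

lemma cas_arithmetic_progression:
  fixes H :: "(nat, nat \<times> nat) pre_digraph"
  assumes "pre_digraph.cas H s q t" "tail H = fst" "head H = snd"
    and "\<And>a b. (a, b) \<in> set q \<Longrightarrow> a + Y \<le> b \<and> b \<le> a + d"
  shows "s + length q * Y \<le> t \<and> t \<le> s + length q * d \<and>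
         (t = s + length q * d \<longrightarrow> (\<forall>i<length q. (s + i * d, s + Suc i * d) \<in> set q))"
  using assms(1,4)
proof (induction q arbitrary: s)
  case Nil
  then show ?case by (simp add: pre_digraph.cas.simps)
next
  case (Cons e q)
  obtain b where e: "e = (s, b)" and cas: "pre_digraph.cas H b q t"
    using Cons.prems(1) assms(2,3) by (cases e) (auto simp: pre_digraph.cas.simps)
  have b: "s + Y \<le> b" "b \<le> s + d"
    using Cons.prems(2)[of s b] e by auto
  have IH: "b + length q * Y \<le> t" "t \<le> b + length q * d"
    "t = b + length q * d \<Longrightarrow> \<forall>i<length q. (b + i * d, b + Suc i * d) \<in> set q"
    using Cons.IH[OF cas] Cons.prems(2) by auto
  have "(s + i * d, s + Suc i * d) \<in> set (e # q)"
    if t: "t = s + length (e # q) * d" and i: "i < length (e # q)" for i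
  proof -
    have "b = s + d" using t IH(2) b by simp
    then show ?thesis
      using IH(3) t i e by (cases i) (auto simp: algebra_simps)
  qed
  then show ?case using b IH(1,2) by auto
qed

text \<open>The starts are distinct residues modulo \<open>d\<close>. This makes progressions of
  equal slope disjoint.\<close>

lemma progression_unique:
  fixes u u' d i i' :: nat
  assumes "u + i * d = u' + i' * d" "u \<in> {1..d}" "u' \<in> {1..d}"
  shows "u = u' \<and> i = i'"
proof -
  have eq: "(u - 1) + i * d = (u' - 1) + i' * d" and lt: "u - 1 < d" "u' - 1 < d"
    using assms by auto
  have "u - 1 = u' - 1"
    using arg_cong[OF eq, of "\<lambda>x. x mod d"] lt by simp
  then have "u = u'" using assms by auto
  moreover have "d > 0" using lt by auto
  ultimately show ?thesis using assms(1) by auto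
qed

section \<open>Demand pairs and the arcs they force\<close>

text \<open>Starts avoid the hub \<open>0\<close> and stop at \<open>Y\<close>, which keeps them
  distinct modulo every step \<open>Y + m\<close>.\<close>

definition hub_pairs :: "nat \<Rightarrow> nat \<Rightarrow> nat \<Rightarrow> (nat \<times> nat) set" where
  "hub_pairs k Y M = (\<lambda>(u, m). (u, u + k * (Y + m))) ` ({1..Y} \<times> {..<M})"

lemma card_hub_pairs_le: "card (hub_pairs k Y M) \<le> Y * M"
  unfolding hub_pairs_def by (rule order_trans[OF card_image_le]) auto

text \<open>The start contributes at most \<open>Y\<close>, the horizontal part at most
  \<open>k * Y\<close>, and the slopes together less than \<open>Y\<close>.\<close>

lemma hub_pairs_end_less:
  fixes u m k Y M n :: nat
  assumes "k * (M - 1) < Y" "(k + 2) * Y < n" "u \<le> Y" "m < M" "i \<le> k"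
  shows "u + i * (Y + m) < n"
proof -
  have "i * (Y + m) \<le> k * (Y + (M - 1))"
    using assms by (intro mult_le_mono) auto
  also have "\<dots> < k * Y + Y" using assms(1) by (simp add: algebra_simps)
  finally show ?thesis using assms(2,3) by simp
qed

lemma dist_hub_pair_le:
  assumes "k * (M - 1) < Y" "(k + 2) * Y < n" "u \<in> {1..Y}" "m < M"
  shows "wf_digraph.\<mu> (hub_graph n Y M) (hub_weight K Y M) u (u + k * (Y + m)) \<le> ereal (k * K ^ m)"
proof -
  interpret digraph "hub_graph n Y M" by (rule digraph_hub_graph)
  define q where "q j = map (\<lambda>i. (u + i * (Y + m), u + Suc i * (Y + m))) [0..<j]" for j
  have "awalk u (q j) (u + j * (Y + m)) \<and> awalk_cost (hub_weight K Y M) (q j) = j * K ^ m"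
    if "j \<le> k" for j
    using that
  proof (induction j)
    case 0
    then show ?case
      using hub_pairs_end_less[OF assms(1,2), of u m 0] assms(3,4) by (simp add: q_def awalk_Nil_iff)
  next
    case (Suc j)
    let ?x = "u + j * (Y + m)" and ?y = "u + Suc j * (Y + m)"
    have "(?x, ?y) \<in> arcs (hub_graph n Y M)"
      using hub_pairs_end_less[OF assms(1,2), of u m j] assms(3,4) Suc.prems
        hub_pairs_end_less[OF assms(1,2), of u m "Suc j"]
      by (auto simp: mem_arcs_hub_graph)
    then have "awalk ?x [(?x, ?y)] ?y"
      by (simp add: awalk_simps mem_arcs_hub_graph)
    moreover have "hub_weight K Y M (?x, ?y) = K ^ m"
      using assms(3) by (auto simp: hub_weight_def)
    moreover have "q (Suc j) = q j @ [(?x, ?y)]"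
      by (simp add: q_def)
    ultimately show ?case
      using Suc by (auto intro: awalk_appendI simp: algebra_simps)
  qed
  from this[of k] show ?thesis
    using min_cost_le_walk_cost by (metis order_refl)
qed

lemma preserver_contains_progression:
  fixes \<alpha> :: real
  assumes pres: "approx_distance_preserver \<alpha> (hub_graph n Y M) (hub_weight K Y M) P H"
    and P: "hub_pairs k Y M \<subseteq> P"
    and par: "k * (M - 1) < Y" "(k + 2) * Y < n" "\<alpha> \<ge> 1" "K > \<alpha> * k" "K \<ge> 1"
    and um: "u \<in> {1..Y}" "m < M" "i < k"
  shows "(u + i * (Y + m), u + Suc i * (Y + m)) \<in> arcs H"
proof -
  let ?G = "hub_graph n Y M" and ?w = "hub_weight K Y M" and ?t = "u + k * (Y + m)"
  have sub: "arcs H \<subseteq> arcs ?G" "tail H = fst" "head H = snd" "wf_digraph H"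
    using pres by (auto simp: approx_distance_preserver_def subgraph_def compatible_def)
  interpret H: wf_digraph H by (rule sub(4))
  have "(u, ?t) \<in> P" using P um by (force simp: hub_pairs_def)
  then have "H.\<mu> ?w u ?t \<le> ereal \<alpha> * wf_digraph.\<mu> ?G ?w u ?t"
    using pres by (auto simp: approx_distance_preserver_def)
  also have "\<dots> \<le> ereal \<alpha> * ereal (k * K ^ m)"
    using dist_hub_pair_le[OF par(1,2) um(1,2)] par(3) by (intro ereal_mult_left_mono) auto
  also have "\<dots> < ereal (K ^ Suc m)"
    using mult_strict_right_mono[OF par(4), of "K ^ m"] par(5) by (simp add: mult_ac)
  \<comment> \<open>Strictness turns the infimum into an actual walk below the threshold.\<close>
  finally obtain q where q: "H.awalk u q ?t" "H.awalk_cost ?w q < K ^ Suc m"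
    by (auto simp: H.\<mu>_def INF_less_iff)
  have qG: "set q \<subseteq> arcs ?G" and cas: "H.cas u q ?t"
    using q(1) sub(1) by (auto simp: H.awalk_def)
  \<comment> \<open>Weights are nonnegative, so each arc of \<open>q\<close> alone stays below
    \<open>K ^ Suc m\<close>; hence it avoids the hub and has slope at most
    \<open>m\<close>.\<close>
  have step: "a + Y \<le> b \<and> b \<le> a + (Y + m)" if e: "(a, b) \<in> set q" for a b
  proof -
    have "?w (a, b) \<le> H.awalk_cost ?w q"
      unfolding H.awalk_cost_def using imageI[OF e, of ?w] par(5)
      by (intro member_le_sum_list) (simp, force simp: hub_weight_def)
    then have less: "?w (a, b) < K ^ Suc m" using q(2) by simp
    have ab: "a \<noteq> 0" "b \<noteq> 0"
      using less um(2) par(5) power_increasing[of "Suc m" M K]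
      by (auto simp: hub_weight_def split: if_splits)
    then have "b - a - Y < Suc m"
      using less par(5) power_increasing[of "Suc m" "b - a - Y" K]
      by (fastforce simp: hub_weight_def not_less[symmetric])
    then show ?thesis using ab qG e by (auto simp: mem_arcs_hub_graph)
  qed
  note ap = cas_arithmetic_progression[OF cas sub(2,3) step]
  have "length q \<ge> k"
  proof -
    have "k * (Y + m) \<le> length q * (Y + m)" using ap by simp
    then show ?thesis using um(1) by simp
  qed
  \<comment> \<open>Every step advances by at least \<open>Y\<close>, while the total advance is
    less than \<open>Suc k * Y\<close> because \<open>k * m < Y\<close>.\<close>
  moreover have "length q \<le> k"
  proof -
    have "k * m \<le> k * (M - 1)" using um(2) by (intro mult_le_mono) auto
    then have "length q * Y < Suc k * Y"
      using ap par(1) by (simp add: algebra_simps)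
    then show ?thesis by (metis mult_less_cancel2 less_Suc_eq_le)
  qed
  ultimately have "length q = k" by simp
  then have "(u + i * (Y + m), u + Suc i * (Y + m)) \<in> set q"
    using ap um(3) by auto
  then show ?thesis using q(1) by (auto simp: H.awalk_def)
qed

lemma finite_arcs_preserver:
  assumes "approx_distance_preserver \<alpha> G w P H" "fin_digraph G"
  shows "finite (arcs H)"
  using assms fin_digraph.finite_arcs finite_subset
  unfolding approx_distance_preserver_def subgraph_def by blast

text \<open>Forced arcs are counted by start, slope and position: the length of an arc reveals its
  slope, and its tail then determines the other two.\<close>

lemma card_arcs_preserver_ge:
  fixes \<alpha> :: real
  assumes pres: "approx_distance_preserver \<alpha> (hub_graph n Y M) (hub_weight K Y M) P H"
    and P: "hub_pairs k Y M \<subseteq> P"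
    and par: "k * (M - 1) < Y" "(k + 2) * Y < n" "\<alpha> \<ge> 1" "K > \<alpha> * k" "K \<ge> 1"
  shows "k * Y * M \<le> card (arcs H)"
proof -
  define A where "A = {1..Y} \<times> {..<M} \<times> {..<k}"
  define f where "f = (\<lambda>(u, m, i). (u + i * (Y + m), u + Suc i * (Y + m)))"
  have "inj_on f A"
  proof (rule inj_onI)
    fix x x' assume x: "x \<in> A" "x' \<in> A" and eq: "f x = f x'"
    obtain u m i u' m' i' where x_eq: "x = (u, m, i)" "x' = (u', m', i')"
      by (metis prod_cases3)
    have m: "m = m'" and "u + i * (Y + m) = u' + i' * (Y + m)"
      using eq by (auto simp: f_def x_eq)
    with progression_unique[of u i "Y + m" u' i'] x show "x = x'"
      by (auto simp: A_def x_eq)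
  qed
  moreover have "f ` A \<subseteq> arcs H"
    using preserver_contains_progression[OF pres P par] by (auto simp: A_def f_def)
  moreover have "finite (arcs H)"
    using finite_arcs_preserver[OF pres digraph.axioms(1)[OF digraph_hub_graph]] .
  ultimately have "card A \<le> card (arcs H)"
    by (metis card_image card_mono)
  then show ?thesis by (simp add: A_def mult_ac)
qed

text \<open>The hub makes every pair admissible, so a small set can be padded to exactly
  \<open>p\<close> pairs.\<close>

lemma obtain_demand_pairs:
  assumes "P0 \<subseteq> {..<n} \<times> {..<n}" "card P0 \<le> p" "p \<le> n ^ 2"
  obtains P where "P0 \<subseteq> P" "demand_pairs (hub_graph n Y M) P" "card P = p"
proof -
  obtain P where "P0 \<subseteq> P" "P \<subseteq> {..<n} \<times> {..<n}" "card P = p"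
    using exists_subset_between[of P0 p "{..<n} \<times> {..<n}"] assms
    by (auto simp: power2_eq_square)
  then show ?thesis
    by (intro that[of P]) (auto simp: demand_pairs_def intro: reachable_hub_graph)
qed

lemma card_arcs_preserver_pos:
  assumes pres: "approx_distance_preserver \<alpha> G w P H"
    and "fin_digraph G" "(s, t) \<in> P" "s \<noteq> t"
  shows "card (arcs H) \<ge> 1"
proof -
  have H: "arcs H \<subseteq> arcs G" "wf_digraph H" "s \<rightarrow>\<^sup>*\<^bsub>H\<^esub> t"
    using pres assms(3) by (auto simp: approx_distance_preserver_def subgraph_def)
  interpret H: wf_digraph H by (rule H(2))
  obtain q where "H.awalk s q t"
    using H(3) by (auto simp: H.reachable_awalk)
  then have "arcs H \<noteq> {}"
    using \<open>s \<noteq> t\<close> by (cases q) (auto simp: H.awalk_simps)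
  moreover have "finite (arcs H)"
    using finite_arcs_preserver[OF pres assms(2)] .
  ultimately show ?thesis by (simp add: Suc_le_eq card_gt_0_iff)
qed

section \<open>Choice of parameters and the final bound\<close>

text \<open>In the first case a single arc meets the bound with constant \<open>1 / 1000\<close>;
  otherwise rounding costs only constant factors.\<close>

lemma parameter_choice:
  fixes n p :: nat
  assumes n: "n \<ge> 2" and p: "real n powr (1/2) \<le> real p" "p \<le> n ^ 2"
  defines "T \<equiv> real n powr (2/3) * real p powr (2/3)"
  obtains "T \<le> 1000"
  | k Y M where "k * (M - 1) < Y" "(k + 2) * Y < n" "Y * M \<le> p" "T / 1000 \<le> real (k * Y * M)"
proof -
  \<comment> \<open>With cube roots, \<open>T\<close> is the square of \<open>A * B\<close>, and the
    range of \<open>p\<close> becomes \<open>B \<le> A\<^sup>2\<close> and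
    \<open>A \<le> B\<^sup>2\<close>.\<close>
  define A B where "A = real n powr (1/3)" and "B = real p powr (1/3)"
  have "real n powr (1/2) > 0" using n by simp
  then have "real p > 0" using p(1) by linarith
  have A: "A > 0" "A ^ 3 = n" and B: "B > 0" "B ^ 3 = p"
    using n \<open>real p > 0\<close> by (auto simp: A_def B_def powr_power)
  have T: "T = (A * B)\<^sup>2"
    using n \<open>real p > 0\<close> by (simp add: T_def A_def B_def power_mult_distrib powr_power)
  have "B ^ 3 \<le> (A\<^sup>2) ^ 3"
    using p(2) A B by (metis of_nat_le_iff of_nat_power power_mult mult.commute)
  then have BA: "B \<le> A\<^sup>2" using A B power_mono_iff[of B "A\<^sup>2" 3] by simp
  have "(real n powr (1/2))\<^sup>2 \<le> (real p)\<^sup>2"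
    using p(1) by (intro power_mono) auto
  then have "A ^ 3 \<le> (B\<^sup>2) ^ 3"
    using n by (simp add: powr_power A(2) flip: B(2) power_mult)
  then have AB: "A \<le> B\<^sup>2" using A B power_mono_iff[of A "B\<^sup>2" 3] by simp
  \<comment> \<open>This is the cube root of \<open>n\<^sup>2 / p\<close>, the ideal order of
    \<open>k\<close>; then \<open>n / r = A * B\<close> is the ideal order of
    \<open>Y\<close>.\<close>
  define r where "r = A\<^sup>2 / B"
  have rB: "r * B = A\<^sup>2" using B by (simp add: r_def)
  have r: "r \<ge> 1" using BA B by (simp add: r_def)
  \<comment> \<open>The factor 2 lets \<open>Y\<^sup>2\<close> and \<open>k * Y\<close> each stay
    below \<open>k * p / 2\<close>, which yields \<open>Y * M \<le> p\<close>.\<close>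
  define k where "k = nat \<lceil>2 * r\<rceil>"
  have k: "2 * r \<le> k" "k \<le> 3 * r" using r unfolding k_def by linarith+
  then have "k > 0" using r by (cases k) auto
  \<comment> \<open>For \<open>n > 0\<close>, the largest \<open>Y\<close> with
    \<open>(k + 2) * Y < n\<close>; likewise \<open>M\<close> below is the largest with
    \<open>k * (M - 1) < Y\<close> if \<open>Y > 0\<close>.\<close>
  define Y where "Y = (n - 1) div (k + 2)"
  define M where "M = (Y - 1) div k + 1"
  have ArB: "real n = A * r * B"
    using A(2) rB by (simp add: power3_eq_cube power2_eq_square mult.assoc)
  have k2: "real (k + 2) \<le> 5 * r" using k r by simp
  show ?thesis
  proof (cases "Y = 0")
    \<comment> \<open>\<open>Y\<close> vanishes only if \<open>n\<close> is of order
      \<open>r\<close>, but \<open>r\<^sup>2 \<le> n\<close>; so \<open>n\<close> is bounded, and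
      \<open>T \<le> n\<^sup>2\<close> with it.\<close>
    case True
    then have "n - 1 < k + 2" by (simp add: Y_def div_eq_0_iff)
    then have "real n - 1 < 5 * r" using k2 by linarith
    then have "(real n - 1)\<^sup>2 \<le> (5 * r)\<^sup>2" using n by (intro power_mono) auto
    moreover have "r\<^sup>2 \<le> n"
    proof -
      have "A * r\<^sup>2 \<le> B\<^sup>2 * r\<^sup>2" using AB by (intro mult_right_mono) auto
      also have "\<dots> = A * n"
        using A(2) rB by (metis mult.commute power_mult_distrib power3_eq_cube power2_eq_square mult.assoc)
      finally show ?thesis using A by simp
    qed
    ultimately have "(real n - 1)\<^sup>2 \<le> 25 * real n" by (simp add: power_mult_distrib)
    then have "real n * (real n - 27) \<le> 0" by (simp add: power2_eq_square algebra_simps)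
    then have n27: "real n \<le> 27" using n by (simp add: mult_le_0_iff)
    have "A * B \<le> n"
      using BA A by (simp add: power3_eq_cube power2_eq_square mult.assoc flip: A(2))
    then have "T \<le> 27\<^sup>2"
      unfolding T using A B n27 by (intro power_mono) auto
    then show ?thesis by (intro that(1)) simp
  next
    case False
    have kY: "(k + 2) * Y < n"
    proof -
      have "(k + 2) * Y \<le> n - 1" unfolding Y_def by (rule times_div_less_eq_dividend)
      then show ?thesis using n by simp
    qed
    have kM: "k * (M - 1) < Y"
    proof -
      have "k * (M - 1) \<le> Y - 1" by (simp add: M_def)
      then show ?thesis using False by simp
    qed
    have YM: "Y \<le> k * M"
      using dividend_less_times_div[OF \<open>k > 0\<close>, of "Y - 1"] by (simp add: M_def)
    have kYn: "real k * Y \<le> n"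
      using kY by (simp flip: of_nat_mult)
    have "real k * (Y * M) \<le> real k * p"
    proof -
      have "k * M \<le> Y + k" using kM by (simp add: M_def)
      then have "k * (Y * M) \<le> Y * (Y + k)"
        by (metis mult.left_commute mult_le_mono2)
      then have "real k * (Y * M) \<le> (real Y)\<^sup>2 + real k * Y"
        by (simp add: power2_eq_square algebra_simps flip: of_nat_mult of_nat_add)
      moreover have "real k * Y \<le> real k * p / 2"
      proof -
        have "n \<le> r * p"
          using AB r B unfolding ArB B(2)[symmetric]
          by (simp add: power3_eq_cube power2_eq_square mult_ac)
        also have "\<dots> \<le> (k / 2) * p" using k(1) by (intro mult_right_mono) auto
        finally show ?thesis using kYn by simp
      qed
      moreover have "(real Y)\<^sup>2 \<le> real k * p / 2"
      proof -
        have "(real k * Y)\<^sup>2 \<le> (real n)\<^sup>2" using kYn by (intro power_mono) auto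
        also have "\<dots> = r ^ 3 * p"
        proof -
          have "(real n)\<^sup>2 = (A\<^sup>2) ^ 3"
            by (simp flip: A(2) power_mult)
          also have "\<dots> = r ^ 3 * p"
            by (simp add: power_mult_distrib flip: rB B(2))
          finally show ?thesis .
        qed
        also have "\<dots> \<le> (k / 2) ^ 3 * p"
          using k(1) r by (intro mult_right_mono power_mono) auto
        finally have "(real k)\<^sup>2 * (real Y)\<^sup>2 \<le> (real k)\<^sup>2 * (k * p / 8)"
          by (simp add: power_mult_distrib power_divide power3_eq_cube power2_eq_square mult_ac)
        then have "(real Y)\<^sup>2 \<le> k * p / 8" using \<open>k > 0\<close> by simp
        also have "\<dots> \<le> k * p / 2" by simp
        finally show ?thesis by simp
      qed
      ultimately show ?thesis by simp
    qed
    then have "Y * M \<le> p" using \<open>k > 0\<close> by (simp flip: of_nat_mult)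
    moreover have "T / 1000 \<le> real (k * Y * M)"
    proof -
      \<comment> \<open>Since \<open>Y \<ge> 1\<close>, rounding down loses at most a factor 2; with
        \<open>k + 2 \<le> 5 * r\<close> this gives the 10 below.\<close>
      have "n - 1 < (k + 2) * (Y + 1)"
        using dividend_less_times_div[of "k + 2" "n - 1"] by (simp add: Y_def)
      also have "\<dots> \<le> (k + 2) * (2 * Y)" using False by (intro mult_le_mono) auto
      finally have "real n \<le> real ((k + 2) * (2 * Y))" by (intro of_nat_mono) simp
      also have "\<dots> \<le> 5 * r * (2 * Y)"
        unfolding of_nat_mult[of "k + 2"] using k2 by (intro mult_mono) auto
      finally have "r * (A * B) \<le> r * (10 * Y)" by (simp add: ArB mult_ac)
      then have "A * B \<le> 10 * Y" using r by simp
      then have "T \<le> (10 * real Y)\<^sup>2" unfolding T using A B by (intro power_mono) auto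
      also have "\<dots> \<le> 1000 * real (Y * Y)" by (simp add: power_mult_distrib power2_eq_square)
      also have "\<dots> \<le> 1000 * real (k * Y * M)"
        using YM mult_le_mono1[of Y "k * M" Y] by (simp add: mult_ac flip: of_nat_mult)
      finally show ?thesis by simp
    qed
    ultimately show ?thesis using kM kY by (intro that(2))
  qed
qed

theorem theorem6p1:
  shows "\<exists>c::real. c > 0 \<and>
    (\<forall>(n::nat) (\<alpha>::real) (p::nat).
       n \<ge> 2 \<longrightarrow> \<alpha> \<ge> 1 \<longrightarrow> real n powr (1/2) \<le> real p \<longrightarrow> p \<le> n ^ 2 \<longrightarrow>
       (\<exists>(G :: (nat, nat \<times> nat) pre_digraph) (w :: (nat \<times> nat) weight_fun) (P :: (nat \<times> nat) set).
          weighted_digraph G w \<and> card (verts G) = n \<and>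
          demand_pairs G P \<and> card P = p \<and>
          (\<forall>H. approx_distance_preserver \<alpha> G w P H \<longrightarrow>
             real (card (arcs H)) \<ge> c * (real n powr (2/3) * real p powr (2/3)))))"
proof (intro exI[of _ "1 / 1000"] conjI allI impI)
  fix n p :: nat and \<alpha> :: real
  assume n: "n \<ge> 2" and \<alpha>: "\<alpha> \<ge> 1" and p: "real n powr (1/2) \<le> real p" "p \<le> n ^ 2"
  let ?T = "real n powr (2/3) * real p powr (2/3)"
  show "\<exists>(G :: (nat, nat \<times> nat) pre_digraph) w P.
      weighted_digraph G w \<and> card (verts G) = n \<and> demand_pairs G P \<and> card P = p \<and>
      (\<forall>H. approx_distance_preserver \<alpha> G w P H \<longrightarrow> real (card (arcs H)) \<ge> 1 / 1000 * ?T)"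
    using n p
  proof (cases rule: parameter_choice)
    case 1
    have "p \<noteq> 0" using p(1) n by (cases p) auto
    \<comment> \<open>With \<open>Y = M = 0\<close> only the hub star remains, and the pair
      \<open>(0, 1)\<close> forces one arc.\<close>
    then obtain P where P: "{(0, 1)} \<subseteq> P" "demand_pairs (hub_graph n 0 0) P" "card P = p"
      using obtain_demand_pairs[of "{(0, 1)}" n p] n p(2) by auto
    have "real (card (arcs H)) \<ge> 1 / 1000 * ?T"
      if "approx_distance_preserver \<alpha> (hub_graph n 0 0) (hub_weight 1 0 0) P H" for H
      using card_arcs_preserver_pos[OF that digraph.axioms(1)[OF digraph_hub_graph], of 0 1] P(1) 1
      by auto
    then show ?thesis
      using P weighted_digraph_hub_graph[of 1 n 0 0]
      by (intro exI[of _ "hub_graph n 0 0"] exI[of _ "hub_weight 1 0 0"] exI[of _ P]) auto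
  next
    case (2 k Y M)
    define K where "K = \<alpha> * k + 1"
    have K: "K > \<alpha> * k" "K \<ge> 1" using \<alpha> by (auto simp: K_def)
    have "u < n \<and> u + k * (Y + m) < n" if "u \<in> {1..Y}" "m < M" for u m
      using hub_pairs_end_less[OF 2(1,2), of u m] that by fastforce
    then have "hub_pairs k Y M \<subseteq> {..<n} \<times> {..<n}"
      by (auto simp: hub_pairs_def)
    then obtain P where P: "hub_pairs k Y M \<subseteq> P" "demand_pairs (hub_graph n Y M) P" "card P = p"
      using obtain_demand_pairs[OF _ order_trans[OF card_hub_pairs_le 2(3)] p(2)] by blast
    have "real (card (arcs H)) \<ge> 1 / 1000 * ?T"
      if "approx_distance_preserver \<alpha> (hub_graph n Y M) (hub_weight K Y M) P H" for H
      using card_arcs_preserver_ge[OF that P(1) 2(1,2) \<alpha> K] 2(4)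
      by (simp del: of_nat_mult)
    then show ?thesis
      using P weighted_digraph_hub_graph[of K n Y M] K(2)
      by (intro exI[of _ "hub_graph n Y M"] exI[of _ "hub_weight K Y M"] exI[of _ P]) auto
  qed
qed simp

end
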